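(* If $G$ is a unicyclic graph that is not a König–Egerváry graph, with unique cycle $C$, then \[ \mathrm{core}(G)=\bigcup\{\mathrm{core}(T_x): x\in N_1(C)\}. \]
   Context: All graphs are finite, simple and undirected. A graph is unicyclic if it is connected and contains exactly one cycle. $\alpha(G)$ is the maximum cardinality of an independent set (a set of pairwise non-adjacent vertices) of $G$, and $\mu(G)$ is the maximum cardinality of a matching of $G$. A graph $G$ on $n$ vertices is a König–Egerváry graph if $\alpha(G)+\mu(G)=n$. $\mathrm{core}(H)$ is the intersection of all maximum independent sets of a graph $H$. For the unique cycle $C$ of $G$, $N_1(C)=\{v\in V(G)\setminus V(C): v \text{ has a neighbor in } V(C)\}$. For $x\in N_1(C)$ with neighbor $y\in V(C)$, $T_x$ denotes the tree which is the connected component containing $x$ of the graph $G-xy$ obtained by deleting the edge $xy$. *)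

theory Defs
  imports Main
begin

record 'a ugraph =
  verts :: "'a set"
  edges :: "'a set set"

definition simple_graph :: "'a ugraph \<Rightarrow> bool" where
  "simple_graph G \<longleftrightarrow>
     finite (verts G) \<and> (\<forall>e\<in>edges G. e \<subseteq> verts G \<and> card e = 2)"

definition adj_rel :: "'a ugraph \<Rightarrow> ('a \<times> 'a) set" where
  "adj_rel G = {(u, v). {u, v} \<in> edges G}"

definition connected_graph :: "'a ugraph \<Rightarrow> bool" where
  "connected_graph G \<longleftrightarrow>
     verts G \<noteq> {} \<and> (\<forall>u\<in>verts G. \<forall>v\<in>verts G. (u, v) \<in> (adj_rel G)\<^sup>*)"

definition component_of :: "'a ugraph \<Rightarrow> 'a \<Rightarrow> 'a ugraph" where
  "component_of G x =
     \<lparr>verts = {v\<in>verts G. (x, v) \<in> (adj_rel G)\<^sup>*},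
      edges = {e\<in>edges G. e \<subseteq> {v\<in>verts G. (x, v) \<in> (adj_rel G)\<^sup>*}}\<rparr>"

definition delete_edge :: "'a ugraph \<Rightarrow> 'a set \<Rightarrow> 'a ugraph" where
  "delete_edge G e = \<lparr>verts = verts G, edges = edges G - {e}\<rparr>"

text \<open>A cycle is a subgraph, not a vertex sequence: the rotations and the reversal of a
  sequence give the same cycle, while two cycles on the same vertices with different
  edges are distinct.\<close>

definition cycle_in :: "'a ugraph \<Rightarrow> 'a ugraph \<Rightarrow> bool" where
  "cycle_in G C \<longleftrightarrow>
     verts C \<subseteq> verts G \<and> edges C \<subseteq> edges G \<and>
     (\<exists>vs. distinct vs \<and> 3 \<le> length vs \<and> verts C = set vs \<and>
        edges C = {{vs ! i, vs ! (Suc i mod length vs)} | i. i < length vs})"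

definition unicyclic :: "'a ugraph \<Rightarrow> bool" where
  "unicyclic G \<longleftrightarrow> connected_graph G \<and> (\<exists>!C. cycle_in G C)"

definition independent_set :: "'a ugraph \<Rightarrow> 'a set \<Rightarrow> bool" where
  "independent_set G S \<longleftrightarrow> S \<subseteq> verts G \<and> (\<forall>u\<in>S. \<forall>v\<in>S. {u, v} \<notin> edges G)"

definition independence_number :: "'a ugraph \<Rightarrow> nat" where
  "independence_number G = Max {card S | S. independent_set G S}"

definition matching :: "'a ugraph \<Rightarrow> 'a set set \<Rightarrow> bool" where
  "matching G M \<longleftrightarrow> M \<subseteq> edges G \<and> (\<forall>e\<in>M. \<forall>f\<in>M. e \<noteq> f \<longrightarrow> e \<inter> f = {})"

definition matching_number :: "'a ugraph \<Rightarrow> nat" where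
  "matching_number G = Max {card M | M. matching G M}"

definition koenig_egervary :: "'a ugraph \<Rightarrow> bool" where
  "koenig_egervary G \<longleftrightarrow>
     independence_number G + matching_number G = card (verts G)"

definition maximum_independent_set :: "'a ugraph \<Rightarrow> 'a set \<Rightarrow> bool" where
  "maximum_independent_set G S \<longleftrightarrow>
     independent_set G S \<and> card S = independence_number G"

definition core :: "'a ugraph \<Rightarrow> 'a set" where
  "core G = \<Inter>{S. maximum_independent_set G S}"

definition N1 :: "'a ugraph \<Rightarrow> 'a ugraph \<Rightarrow> 'a set" where
  "N1 G C = {v\<in>verts G - verts C. \<exists>y\<in>verts C. {v, y} \<in> edges G}"

text \<open>The tree \<open>T\<^sub>x\<close>, with the neighbour \<open>y\<close> of \<open>x\<close> on the cycle as an explicit argument.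
  In a unicyclic graph \<open>y\<close> is determined by \<open>x\<close>, since a second neighbour on the cycle would
  close a second cycle.\<close>

definition attached_tree :: "'a ugraph \<Rightarrow> 'a \<Rightarrow> 'a \<Rightarrow> 'a ugraph" where
  "attached_tree G x y = component_of (delete_edge G {x, y}) x"

end

(* Let K be the vertex set of the cycle; the other vertices are partitioned by the trees T_x. Trees,
   and all induced subgraphs missing a cycle vertex, are Koenig-Egervary (KE) by induction on leaves.
   If a vertex v of a graph H lies in core(H) and H - v is KE, then some matching M avoiding v has
   alpha(H) + |M| >= |V(H)|. If x were in core(T_x), adding the edge xy to such a matching of T_x
   and to a maximum matching of the forest G - T_x - y would make G a KE graph. So every T_x has a
   maximum independent set avoiding x, which gives alpha(G) = alpha(G[K]) + sum alpha(T_x).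
   If some y were in core(G[K]), the matchings of the parts would again add up to make G KE. So the
   maximum independent sets of the parts can be glued with enough freedom to read off core(G).
   The parity of the cycle plays no role. *)
theory Submission
  imports Defs
begin

section \<open>Independent sets, matchings and induced subgraphs\<close>

text \<open>\<open>W\<close> is not intersected with \<open>verts G\<close>, so that
  \<open>verts_induced\<close> holds unconditionally. Lemmas that need \<open>W\<close> inside the
  graph assume so.\<close>

definition induced :: "'a ugraph \<Rightarrow> 'a set \<Rightarrow> 'a ugraph" where
  "induced G W = \<lparr>verts = W, edges = {e \<in> edges G. e \<subseteq> W}\<rparr>"

lemma verts_induced [simp]: "verts (induced G W) = W"
  by (simp add: induced_def)

lemma simple_graph_induced:
  "simple_graph G \<Longrightarrow> W \<subseteq> verts G \<Longrightarrow> simple_graph (induced G W)"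
  by (auto simp: simple_graph_def induced_def intro: finite_subset)

lemma induced_induced: "U \<subseteq> W \<Longrightarrow> induced (induced G W) U = induced G U"
  by (auto simp: induced_def)

lemma independent_set_induced_iff:
  "W \<subseteq> verts G \<Longrightarrow> independent_set (induced G W) S \<longleftrightarrow> S \<subseteq> W \<and> independent_set G S"
  unfolding independent_set_def induced_def
  by (simp add: subset_eq) (meson subset_iff)

lemma matching_induced_iff:
  "matching (induced G W) M \<longleftrightarrow> matching G M \<and> \<Union>M \<subseteq> W"
  by (auto simp: matching_def induced_def)

lemma simple_graph_edgeD:
  assumes "simple_graph G" "{u, v} \<in> edges G"
  shows "u \<in> verts G" "v \<in> verts G" "u \<noteq> v"
  using assms by (auto simp: simple_graph_def)

lemma finite_edges: "simple_graph G \<Longrightarrow> finite (edges G)"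
  by (rule finite_subset[of _ "Pow (verts G)"]) (auto simp: simple_graph_def)

lemma matching_Un:
  assumes G: "simple_graph G" and A: "matching G A" and B: "matching G B"
    and disj: "\<Union>A \<inter> \<Union>B = {}"
  shows "matching G (A \<union> B)" "card (A \<union> B) = card A + card B"
proof -
  have ab: "a \<inter> b = {}" if "a \<in> A" "b \<in> B" for a b using disj that by blast
  then have ba: "b \<inter> a = {}" if "a \<in> A" "b \<in> B" for a b using that by blast
  show "matching G (A \<union> B)"
    unfolding matching_def
  proof (intro conjI ballI impI)
    show "A \<union> B \<subseteq> edges G" using A B by (simp add: matching_def)
    fix e f assume ef: "e \<in> A \<union> B" "f \<in> A \<union> B" "e \<noteq> f"
    then consider "e \<in> A" "f \<in> A" | "e \<in> B" "f \<in> B" | "e \<in> A" "f \<in> B" | "e \<in> B" "f \<in> A"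
      by blast
    then show "e \<inter> f = {}"
      using A B ab ba ef(3) by cases (simp_all add: matching_def)
  qed
  have "finite A" "finite B"
    using A B finite_subset[OF _ finite_edges[OF G]] by (simp_all add: matching_def)
  \<comment> \<open>A common edge would be disjoint from itself, hence empty, whereas edges have two
    vertices.\<close>
  moreover have "A \<inter> B = {}"
  proof (rule equals0I)
    fix e assume e: "e \<in> A \<inter> B"
    then have "e = {}" using ab[of e e] by simp
    then show False using e A G by (force simp: matching_def simple_graph_def)
  qed
  ultimately show "card (A \<union> B) = card A + card B" by (rule card_Un_disjoint)
qed

section \<open>Maximum independent sets and maximum matchings\<close>

lemma finite_independent_cards:
  assumes "simple_graph G" shows "finite {card S |S. independent_set G S}"
proof -
  have "{card S |S. independent_set G S} \<subseteq> card ` Pow (verts G)"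
    by (auto simp: independent_set_def)
  then show ?thesis
    by (rule finite_subset) (use assms in \<open>simp add: simple_graph_def\<close>)
qed

lemma finite_matching_cards:
  assumes "simple_graph G" shows "finite {card M |M. matching G M}"
proof -
  have "{card M |M. matching G M} \<subseteq> card ` Pow (edges G)"
    by (auto simp: matching_def)
  then show ?thesis
    by (rule finite_subset) (simp add: finite_edges[OF assms])
qed

lemma independent_set_card_le:
  "simple_graph G \<Longrightarrow> independent_set G S \<Longrightarrow> card S \<le> independence_number G"
  unfolding independence_number_def by (rule Max_ge) (auto simp: finite_independent_cards)

lemma matching_card_le:
  "simple_graph G \<Longrightarrow> matching G M \<Longrightarrow> card M \<le> matching_number G"
  unfolding matching_number_def by (rule Max_ge) (auto simp: finite_matching_cards)

lemma ex_maximum_independent_set: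
  assumes "simple_graph G" obtains S where "maximum_independent_set G S"
proof -
  \<comment> \<open>The empty set shows that the maximum is taken over a nonempty set and is
    therefore attained.\<close>
  have "card {} \<in> {card S |S. independent_set G S}"
    by (force simp: independent_set_def)
  then have "independence_number G \<in> {card S |S. independent_set G S}"
    unfolding independence_number_def
    by (intro Max_in) (auto simp only: finite_independent_cards[OF assms])
  then show ?thesis
    using that by (auto simp: maximum_independent_set_def)
qed

lemma ex_maximum_matching:
  assumes "simple_graph G" obtains M where "matching G M" "card M = matching_number G"
proof -
  have "card {} \<in> {card M |M. matching G M}"
    by (force simp: matching_def)
  then have "matching_number G \<in> {card M |M. matching G M}"
    unfolding matching_number_def
    by (intro Max_in) (auto simp only: finite_matching_cards[OF assms])
  then show ?thesis
    using that by force
qed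

text \<open>Rests on the existence of a maximum independent set: the intersection of an empty family
  would be \<open>UNIV\<close>.\<close>

lemma core_subset_verts: "simple_graph G \<Longrightarrow> core G \<subseteq> verts G"
  by (erule ex_maximum_independent_set)
    (auto simp: core_def maximum_independent_set_def independent_set_def)

text \<open>Each matching edge has an end outside \<open>S\<close>, and disjoint edges have
  different ends, so \<open>M\<close> injects into the complement of \<open>S\<close>.\<close>

lemma independent_matching_card_le:
  assumes G: "simple_graph G" and S: "independent_set G S" and M: "matching G M"
  shows "card S + card M \<le> card (verts G)"
proof -
  have fin: "finite (verts G)" and SV: "S \<subseteq> verts G"
    using G S by (auto simp: simple_graph_def independent_set_def)
  have "\<exists>v. v \<in> e \<and> v \<in> verts G - S" if "e \<in> M" for e
  proof -
    have e: "e \<in> edges G" using M that by (auto simp: matching_def)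
    then obtain u v where "e = {u, v}"
      using G by (auto simp: simple_graph_def card_2_iff)
    moreover from this have "u \<in> verts G" "v \<in> verts G"
      using e simple_graph_edgeD[OF G] by auto
    moreover have "u \<notin> S \<or> v \<notin> S"
      using S e \<open>e = {u, v}\<close> by (auto simp: independent_set_def)
    ultimately show ?thesis by blast
  qed
  then obtain f where f: "\<And>e. e \<in> M \<Longrightarrow> f e \<in> e \<and> f e \<in> verts G - S"
    by metis
  have "inj_on f M"
    using M f unfolding inj_on_def matching_def by (metis IntI empty_iff)
  moreover have "f ` M \<subseteq> verts G - S" using f by auto
  ultimately have "card M \<le> card (verts G - S)"
    using fin by (intro card_inj_on_le[where f = f]) auto
  moreover have "card (verts G - S) = card (verts G) - card S"
    using SV fin by (simp add: card_Diff_subset finite_subset)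
  moreover have "card S \<le> card (verts G)" using SV fin by (simp add: card_mono)
  ultimately show ?thesis by simp
qed

text \<open>Since independent sets and matchings never exceed the vertex count together, a pair
  reaching it certifies that both are optimal.\<close>

lemma koenig_egervaryI:
  assumes "simple_graph G" "independent_set G S" "matching G M"
    and "card (verts G) \<le> card S + card M"
  shows "koenig_egervary G"
proof -
  obtain S' where "maximum_independent_set G S'"
    using ex_maximum_independent_set[OF assms(1)] .
  moreover obtain M' where "matching G M'" "card M' = matching_number G"
    using ex_maximum_matching[OF assms(1)] .
  ultimately have "independence_number G + matching_number G \<le> card (verts G)"
    using independent_matching_card_le[OF assms(1)] by (metis maximum_independent_set_def)
  then show ?thesis
    using independent_set_card_le[OF assms(1,2)] matching_card_le[OF assms(1,3)] assms(4)
    by (simp add: koenig_egervary_def)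
qed

text \<open>Deleting a core vertex lowers the independence number, and the Koenig-Egervary property
  of the rest turns this into a large matching.\<close>

lemma core_vertex_matching:
  assumes G: "simple_graph G" and v: "v \<in> core G"
    and KE: "koenig_egervary (induced G (verts G - {v}))"
  obtains M where "matching G M" "v \<notin> \<Union>M" "card (verts G) \<le> independence_number G + card M"
proof -
  let ?H = "induced G (verts G - {v})"
  have H: "simple_graph ?H" by (simp add: G simple_graph_induced)
  obtain S where S: "maximum_independent_set ?H S"
    using ex_maximum_independent_set[OF H] .
  have SG: "independent_set G S" "v \<notin> S"
    using S by (auto simp: maximum_independent_set_def independent_set_induced_iff)
  have "\<not> maximum_independent_set G S"
    using v SG(2) by (auto simp: core_def)
  then have "card S < independence_number G"
    using SG independent_set_card_le[OF G SG(1)] by (auto simp: maximum_independent_set_def)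
  then have less: "independence_number ?H < independence_number G"
    using S by (simp add: maximum_independent_set_def)
  obtain M where M: "matching ?H M" "card M = matching_number ?H"
    using ex_maximum_matching[OF H] .
  have "v \<in> verts G" using v core_subset_verts[OF G] by blast
  then have "card (verts G) = Suc (card (verts G - {v}))"
    using G by (metis card.remove simple_graph_def)
  \<comment> \<open>The drop of the independence number by at least one pays for the deleted
    vertex.\<close>
  then have "card (verts G) \<le> independence_number G + card M"
    using KE less M(2) by (simp add: koenig_egervary_def)
  with M(1) show ?thesis
    by (intro that[of M]) (auto simp: matching_induced_iff)
qed

text \<open>The assumption \<open>leaf\<close> is acyclicity in a form that subsets inherit. Greedy
  induction: a vertex of degree at most one joins the independent set, its edge, if any, joins the
  matching, and both ends are removed.\<close>

lemma koenig_egervary_if_leaves: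
  assumes G: "simple_graph G" and W: "W \<subseteq> verts G"
    and leaf: "\<And>U. U \<subseteq> W \<Longrightarrow> U \<noteq> {} \<Longrightarrow>
      \<exists>u\<in>U. \<forall>a\<in>U. \<forall>b\<in>U. {u, a} \<in> edges G \<longrightarrow> {u, b} \<in> edges G \<longrightarrow> a = b"
  shows "koenig_egervary (induced G W)"
proof -
  have "finite W" using G W by (auto simp: simple_graph_def finite_subset)
  then have "\<exists>S M. S \<subseteq> W \<and> independent_set G S \<and> matching G M \<and> \<Union>M \<subseteq> W \<and>
      card W \<le> card S + card M"
    using W leaf
  proof (induction W rule: finite_psubset_induct)
    case (psubset W)
    show ?case
    proof (cases "W = {}")
      case True
      then show ?thesis by (auto simp: independent_set_def matching_def intro!: exI[of _ "{}"])
    next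
      case False
      then obtain u where u: "u \<in> W"
        and deg: "\<And>a b. a \<in> W \<Longrightarrow> b \<in> W \<Longrightarrow> {u, a} \<in> edges G \<Longrightarrow> {u, b} \<in> edges G \<Longrightarrow> a = b"
        using psubset.prems(2)[of W] by blast
      define N where "N = {a \<in> W. {u, a} \<in> edges G}"
      define W' where "W' = W - insert u N"
      have W': "W' \<subset> W" using u by (auto simp: W'_def)
      obtain S M where SM: "S \<subseteq> W'" "independent_set G S" "matching G M" "\<Union>M \<subseteq> W'"
        "card W' \<le> card S + card M"
      proof -
        have "W' \<subseteq> verts G" using W' psubset.prems(1) by blast
        moreover have "\<exists>u\<in>U. \<forall>a\<in>U. \<forall>b\<in>U. {u, a} \<in> edges G \<longrightarrow> {u, b} \<in> edges G \<longrightarrow> a = b"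
          if "U \<subseteq> W'" "U \<noteq> {}" for U
          by (rule psubset.prems(2)) (use that W' in auto)
        ultimately show ?thesis using psubset.IH[OF W'] that by blast
      qed
      have finS: "finite S" using SM(1) W' psubset.hyps by (meson finite_subset psubset_imp_subset)
      have finM: "finite M" using SM(3) finite_edges[OF G] by (auto simp: matching_def finite_subset)
      have nouu: "{u} \<notin> edges G" using G by (auto simp: simple_graph_def)
      have S'sub: "insert u S \<subseteq> W" "u \<notin> S"
        using SM(1) u by (auto simp: W'_def)
      \<comment> \<open>All neighbours of \<open>u\<close> in \<open>W\<close> were removed with it,
        and \<open>S\<close> lives in the remainder.\<close>
      have "{u, s} \<notin> edges G" "{s, u} \<notin> edges G" if "s \<in> S" for s
        using that SM(1) by (auto simp: W'_def N_def insert_commute)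
      then have "independent_set G (insert u S)"
        using SM(2) u psubset.prems(1) nouu by (simp add: independent_set_def subset_iff)
      note S' = this S'sub
      show ?thesis
      proof (cases "N = {}")
        case True
        then have "card W = Suc (card W')"
          using card.remove[OF psubset.hyps u] by (simp add: W'_def)
        then show ?thesis
          using S' SM finS W' by (intro exI[of _ "insert u S"] exI[of _ M]) auto
      next
        case False
        then obtain w where w: "w \<in> W" "{u, w} \<in> edges G" by (auto simp: N_def)
        then have N: "N = {w}" using deg by (auto simp: N_def)
        have "u \<noteq> w" using w nouu by auto
        have "card W = card W' + 2"
        proof -
          have "card W' = card W - card {u, w}"
            unfolding W'_def N using u w by (intro card_Diff_subset) auto
          moreover have "card {u, w} \<le> card W"
            using u w psubset.hyps by (intro card_mono) auto
          ultimately show ?thesis using \<open>u \<noteq> w\<close> by simp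
        qed
        moreover have "matching G (insert {u, w} M)" "{u, w} \<notin> M"
          using SM(3,4) w unfolding matching_def W'_def N by blast+
        ultimately show ?thesis
          using S' SM finS finM W' u w
          by (intro exI[of _ "insert u S"] exI[of _ "insert {u, w} M"]) auto
      qed
    qed
  qed
  then show ?thesis
    using W G by (auto simp: independent_set_induced_iff matching_induced_iff
        intro!: koenig_egervaryI simple_graph_induced)
qed

section \<open>Finding cycles\<close>

definition cycle_of_list :: "'a list \<Rightarrow> 'a ugraph" where
  "cycle_of_list vs =
     \<lparr>verts = set vs, edges = {{vs ! i, vs ! (Suc i mod length vs)} |i. i < length vs}\<rparr>"

lemma cycle_in_cycle_of_list:
  assumes "distinct vs" "3 \<le> length vs" "set vs \<subseteq> verts G"
    and succ: "successively (\<lambda>u v. {u, v} \<in> edges G) vs"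
    and last: "{last vs, hd vs} \<in> edges G"
  shows "cycle_in G (cycle_of_list vs)"
proof -
  have "{vs ! i, vs ! (Suc i mod length vs)} \<in> edges G" if "i < length vs" for i
  proof (cases "Suc i < length vs")
    case True
    then show ?thesis using succ by (simp add: successively_conv_nth)
  next
    case False
    \<comment> \<open>The last index wraps around to 0 and yields the closing edge.\<close>
    then have "i = length vs - 1" "Suc i mod length vs = 0" using that
      by (auto simp: less_Suc_eq_le le_antisym mod_Suc)
    then show ?thesis using last assms(2)
      by (cases "vs = []") (auto simp: last_conv_nth hd_conv_nth)
  qed
  then show ?thesis
    using assms(1-3) by (auto simp: cycle_in_def cycle_of_list_def)
qed

text \<open>In a longest path inside \<open>W\<close>, every neighbour in \<open>W\<close> of the
  first vertex lies on the path. One that is not the second vertex closes a cycle with an initial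
  segment.\<close>

lemma min_degree_two_imp_cycle:
  assumes G: "simple_graph G" and W: "W \<subseteq> verts G" "W \<noteq> {}"
    and deg: "\<And>u. u \<in> W \<Longrightarrow> \<exists>a\<in>W. \<exists>b\<in>W. {u, a} \<in> edges G \<and> {u, b} \<in> edges G \<and> a \<noteq> b"
  obtains D where "cycle_in G D" "verts D \<subseteq> W"
proof -
  define path where "path vs \<longleftrightarrow> vs \<noteq> [] \<and> distinct vs \<and> set vs \<subseteq> W \<and>
    successively (\<lambda>u v. {u, v} \<in> edges G) vs" for vs
  have "finite W" using G W by (auto simp: simple_graph_def finite_subset)
  then have "length vs < Suc (card W)" if "path vs" for vs
    using that by (metis card_mono distinct_card less_Suc_eq_le path_def)
  moreover obtain w where "path [w]" using W by (auto simp: path_def)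
  ultimately obtain vs where vs: "path vs" and max: "\<And>us. path us \<Longrightarrow> length us \<le> length vs"
    using ex_has_greatest_nat[of path "[w]" length "Suc (card W)"] by auto
  obtain v ws where vws: "vs = v # ws" using vs by (cases vs) (auto simp: path_def)
  have nb: "b \<in> set ws" if b: "b \<in> W" "{v, b} \<in> edges G" for b
  proof (rule ccontr)
    assume "b \<notin> set ws"
    moreover have "b \<noteq> v" using b G by (auto simp: simple_graph_def)
    ultimately have "path (b # vs)"
      using vs b by (simp add: path_def vws insert_commute)
    then show False using max by force
  qed
  have "v \<in> W" using vs by (simp add: path_def vws)
  \<comment> \<open>Of two distinct neighbours at least one differs from \<open>hd ws\<close>. This
    also holds if \<open>ws\<close> is empty and \<open>hd ws\<close> unspecified; \<open>nb\<close>
    then rules that case out.\<close>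
  then obtain b where b: "b \<in> W" "{v, b} \<in> edges G" "b \<noteq> hd ws"
    using deg by metis
  then obtain us zs where ws: "ws = us @ b # zs" using nb split_list by metis
  have "us \<noteq> []" using b ws by auto
  then have "3 \<le> length (v # us @ [b])" by (cases us) auto
  moreover have "set (v # us @ [b]) \<subseteq> W" "distinct (v # us @ [b])"
    "successively (\<lambda>u v. {u, v} \<in> edges G) (v # us @ [b])"
    using vs \<open>us \<noteq> []\<close> by (auto simp: path_def vws ws successively_append_iff successively_Cons)
  ultimately show ?thesis
    using W b by (intro that[of "cycle_of_list (v # us @ [b])"] cycle_in_cycle_of_list)
      (auto simp: cycle_of_list_def insert_commute)
qed

lemma rtrancl_adj_rel_imp_path:
  assumes "(x, y) \<in> (adj_rel G)\<^sup>*"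
  obtains vs where "vs \<noteq> []" "distinct vs" "hd vs = x" "last vs = y"
    "successively (\<lambda>u v. {u, v} \<in> edges G) vs"
proof -
  have "\<exists>vs. vs \<noteq> [] \<and> distinct vs \<and> hd vs = x \<and> last vs = y \<and>
    successively (\<lambda>u v. {u, v} \<in> edges G) vs"
    using assms
  proof (induction rule: rtrancl_induct)
    case base
    show ?case by (rule exI[of _ "[x]"]) simp
  next
    case (step y z)
    then obtain vs where vs: "vs \<noteq> []" "distinct vs" "hd vs = x" "last vs = y"
      "successively (\<lambda>u v. {u, v} \<in> edges G) vs" by blast
    show ?case
    proof (cases "z \<in> set vs")
      \<comment> \<open>A walk that returns to an earlier vertex \<open>z\<close> is cut off at that
        vertex.\<close>
      case True
      then obtain us ws where "vs = us @ z # ws" by (meson split_list)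
      then show ?thesis using vs
        by (intro exI[of _ "us @ [z]"])
          (auto simp: successively_append_iff hd_append split: if_splits)
    next
      case False
      then show ?thesis using vs step(2)
        by (intro exI[of _ "vs @ [z]"]) (auto simp: successively_append_iff adj_rel_def)
    qed
  qed
  then show ?thesis using that by blast
qed

text \<open>A path from \<open>x\<close> to \<open>y\<close> that avoids the edge is closed by the
  edge itself.\<close>

lemma cycle_through_edge:
  assumes G: "simple_graph G" and xy: "{x, y} \<in> edges G"
    and reach: "(x, y) \<in> (adj_rel (delete_edge G {x, y}))\<^sup>*"
  obtains D where "cycle_in G D" "x \<in> verts D"
proof -
  let ?E = "edges (delete_edge G {x, y})"
  obtain vs where vs: "vs \<noteq> []" "distinct vs" "hd vs = x" "last vs = y"
    and succ: "successively (\<lambda>u v. {u, v} \<in> ?E) vs"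
    using rtrancl_adj_rel_imp_path[OF reach] .
  have "x \<noteq> y" using simple_graph_edgeD[OF G xy] by simp
  then obtain v ws where ws: "vs = x # v # ws"
    using vs by (cases vs; cases "tl vs") auto
  \<comment> \<open>Otherwise the path is \<open>[x, y]\<close>, whose only step is the deleted
    edge.\<close>
  have "ws \<noteq> []" using vs succ by (auto simp: ws delete_edge_def)
  then have len: "3 \<le> length vs" by (cases ws) (auto simp: ws)
  have succG: "successively (\<lambda>u v. {u, v} \<in> edges G) vs"
    using succ by (rule successively_mono) (auto simp: delete_edge_def)
  have "u \<in> verts G" if u: "u \<in> set vs" for u
  proof -
    obtain i where i: "i < length vs" "u = vs ! i" using u by (auto simp: in_set_conv_nth)
    show ?thesis
    proof (cases i)
      case 0
      then show ?thesis using i simple_graph_edgeD[OF G xy] by (simp add: ws)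
    next
      case (Suc j)
      then have "{vs ! j, u} \<in> edges G" using succG i by (simp add: successively_conv_nth)
      then show ?thesis using simple_graph_edgeD[OF G] by blast
    qed
  qed
  then have "cycle_in G (cycle_of_list vs)"
    using vs len succG xy by (intro cycle_in_cycle_of_list) (auto simp: insert_commute)
  then show ?thesis
    using that by (simp add: cycle_of_list_def ws)
qed

text \<open>Going once around the cycle from \<open>z\<close> never leaves \<open>T\<close>.\<close>

lemma cycle_closed_subset:
  assumes C: "cycle_in G C" and z: "z \<in> verts C" "z \<in> T"
    and closed: "\<And>u v. u \<in> verts C \<Longrightarrow> v \<in> verts C \<Longrightarrow> u \<in> T \<Longrightarrow> {u, v} \<in> edges G \<Longrightarrow> v \<in> T"
  shows "verts C \<subseteq> T"
proof -
  obtain vs where vs: "3 \<le> length vs" "verts C = set vs" "edges C \<subseteq> edges G"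
    "edges C = {{vs ! i, vs ! (Suc i mod length vs)} | i. i < length vs}"
    using C unfolding cycle_in_def by auto
  let ?n = "length vs"
  have n: "0 < ?n" using vs by linarith
  obtain i where i: "i < ?n" "z = vs ! i" using z(1) vs(2) by (auto simp: in_set_conv_nth)
  have around: "vs ! ((i + k) mod ?n) \<in> T" for k
  proof (induction k)
    case 0
    then show ?case using i z by simp
  next
    case (Suc k)
    have "{vs ! ((i + k) mod ?n), vs ! (Suc ((i + k) mod ?n) mod ?n)} \<in> edges G"
      using vs(3,4) n by (auto intro: mod_less_divisor)
    then have "{vs ! ((i + k) mod ?n), vs ! ((i + Suc k) mod ?n)} \<in> edges G"
      by (simp add: mod_Suc_eq)
    moreover have "vs ! ((i + m) mod ?n) \<in> verts C" for m using n vs(2) by simp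
    ultimately show ?case using Suc closed by blast
  qed
  show ?thesis
  proof
    fix v assume "v \<in> verts C"
    then obtain j where j: "j < ?n" "v = vs ! j" using vs(2) by (auto simp: in_set_conv_nth)
    \<comment> \<open>The shift goes once past the end of the list, so \<open>j\<close> may be
      smaller than \<open>i\<close> without a truncated difference.\<close>
    have "(i + (?n - i + j)) mod ?n = j" using i(1) j(1) by simp
    then show "v \<in> T" using around j by metis
  qed
qed

section \<open>Trees attached to the cycle\<close>

locale unicyclic_graph =
  fixes G C :: "'a ugraph"
  assumes simple: "simple_graph G"
    and connected: "connected_graph G"
    and cycle: "cycle_in G C"
    and unique_cycle: "\<And>D. cycle_in G D \<Longrightarrow> D = C"
begin

text \<open>Pairs, because \<open>attached_tree\<close> takes the cycle end explicitly. That
  \<open>x\<close> determines \<open>y\<close> follows from \<open>tree_eqI\<close> with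
  \<open>x\<close> as the common vertex.\<close>

definition links :: "('a \<times> 'a) set" where
  "links = {(x, y). x \<in> N1 G C \<and> y \<in> verts C \<and> {x, y} \<in> edges G}"

definition tree :: "'a \<Rightarrow> 'a \<Rightarrow> 'a set" where
  "tree x y = verts (attached_tree G x y)"

definition parts :: "'a set set" where
  "parts = insert (verts C) {tree x y |x y. (x, y) \<in> links}"

abbreviation alpha :: "'a set \<Rightarrow> nat" where
  "alpha X \<equiv> independence_number (induced G X)"

lemma linksD:
  assumes "(x, y) \<in> links"
  shows "x \<in> verts G" "x \<notin> verts C" "y \<in> verts C" "{x, y} \<in> edges G"
  using assms by (auto simp: links_def N1_def)

lemma finite_verts: "finite (verts G)"
  using simple by (simp add: simple_graph_def)

lemma cycle_verts: "verts C \<subseteq> verts G"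
  using cycle by (simp add: cycle_in_def)

lemma tree_iff:
  "v \<in> tree x y \<longleftrightarrow> v \<in> verts G \<and> (x, v) \<in> (adj_rel (delete_edge G {x, y}))\<^sup>*"
  by (simp add: tree_def attached_tree_def component_of_def delete_edge_def)

lemma tree_subset: "tree x y \<subseteq> verts G"
  by (auto simp: tree_iff)

lemma tree_root: "(x, y) \<in> links \<Longrightarrow> x \<in> tree x y"
  by (simp add: tree_iff linksD)

lemma tree_step:
  assumes "u \<in> tree x y" "{u, v} \<in> edges G" "{u, v} \<noteq> {x, y}"
  shows "v \<in> tree x y"
proof -
  have "(u, v) \<in> adj_rel (delete_edge G {x, y})"
    using assms by (simp add: adj_rel_def delete_edge_def)
  then show ?thesis
    using assms(1) simple_graph_edgeD[OF simple assms(2)]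
    by (auto simp: tree_iff intro: rtrancl_into_rtrancl)
qed

text \<open>Otherwise the edge \<open>{x, y}\<close> would lie on a cycle through \<open>x\<close>,
  but the only cycle avoids \<open>x\<close>.\<close>

lemma cycle_vertex_notin_tree:
  assumes xy: "(x, y) \<in> links" shows "y \<notin> tree x y"
proof
  assume "y \<in> tree x y"
  then obtain D where "cycle_in G D" "x \<in> verts D"
    using cycle_through_edge[OF simple linksD(4)[OF xy]] by (auto simp: tree_iff)
  then show False using unique_cycle linksD(2)[OF xy] by blast
qed

text \<open>Edges between cycle vertices differ from \<open>{x, y}\<close>, so a tree that meets the
  cycle would swallow all of it, including \<open>y\<close>.\<close>

lemma tree_disjoint_cycle:
  assumes xy: "(x, y) \<in> links" shows "tree x y \<inter> verts C = {}"
proof (rule ccontr)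
  assume "tree x y \<inter> verts C \<noteq> {}"
  then obtain z where z: "z \<in> verts C" "z \<in> tree x y" by blast
  have "verts C \<subseteq> tree x y"
    using cycle z
  proof (rule cycle_closed_subset)
    fix u v assume "u \<in> verts C" "v \<in> verts C" "u \<in> tree x y" "{u, v} \<in> edges G"
    moreover from this have "{u, v} \<noteq> {x, y}" using linksD(2)[OF xy] by (auto simp: doubleton_eq_iff)
    ultimately show "v \<in> tree x y" using tree_step by blast
  qed
  then show False using cycle_vertex_notin_tree[OF xy] linksD(3)[OF xy] by blast
qed

lemma tree_exit:
  assumes xy: "(x, y) \<in> links" and "u \<in> tree x y" "v \<notin> tree x y" "{u, v} \<in> edges G"
  shows "u = x" "v = y"
proof -
  have "{u, v} = {x, y}" using tree_step assms by blast
  then show "u = x" "v = y"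
    using assms(2) cycle_vertex_notin_tree[OF xy] by (auto simp: doubleton_eq_iff)
qed

text \<open>Deleting \<open>{x, y}\<close> removes no edge inside the tree, since \<open>y\<close>
  is outside. This lets the results on induced subgraphs apply to the attached trees.\<close>

lemma attached_tree_eq:
  assumes xy: "(x, y) \<in> links" shows "attached_tree G x y = induced G (tree x y)"
  using cycle_vertex_notin_tree[OF xy]
  by (auto simp: attached_tree_def component_of_def delete_edge_def induced_def tree_def)

text \<open>A path inside the first tree could enter the second one only from \<open>y'\<close>, but
  the first tree avoids the cycle. So \<open>x\<close> lies in the second tree, and
  \<open>{x, y}\<close> must be the one edge that leaves it.\<close>

lemma tree_eqI:
  assumes xy: "(x, y) \<in> links" and xy': "(x', y') \<in> links"
    and z: "z \<in> tree x y" "z \<in> tree x' y'"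
  shows "x = x'" "y = y'"
proof -
  have "x \<in> tree x' y'"
  proof (rule ccontr)
    assume x: "x \<notin> tree x' y'"
    have "(x, z) \<in> (adj_rel (delete_edge G {x, y}))\<^sup>*" using z by (simp add: tree_iff)
    then have "z \<in> tree x y - tree x' y'"
    proof (induction rule: rtrancl_induct)
      case base
      show ?case using x tree_root[OF xy] by blast
    next
      case (step u v)
      have uv: "{u, v} \<in> edges G" "{u, v} \<noteq> {x, y}"
        using step(2) by (auto simp: adj_rel_def delete_edge_def)
      then have "v \<in> tree x y" using step.IH tree_step by blast
      moreover have "v \<notin> tree x' y'"
      proof
        assume "v \<in> tree x' y'"
        then have "u = y'" using tree_exit[OF xy'] step.IH uv(1) by (metis DiffD2 insert_commute)
        then show False using step.IH tree_disjoint_cycle[OF xy] linksD(3)[OF xy'] by blast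
      qed
      ultimately show ?case by blast
    qed
    then show False using z by blast
  qed
  moreover have "y \<notin> tree x' y'"
    using tree_disjoint_cycle[OF xy'] linksD(3)[OF xy] by blast
  ultimately show "x = x'" "y = y'"
    using tree_exit[OF xy'] linksD(4)[OF xy] by blast+
qed

section \<open>The partition into the cycle and its trees\<close>

lemma parts_cases:
  assumes "X \<in> parts"
  obtains "X = verts C" | x y where "(x, y) \<in> links" "X = tree x y"
  using assms by (auto simp: parts_def)

lemma cycle_in_parts: "verts C \<in> parts"
  by (simp add: parts_def)

lemma tree_in_parts: "(x, y) \<in> links \<Longrightarrow> tree x y \<in> parts"
  by (auto simp: parts_def)

lemma parts_subset: "X \<in> parts \<Longrightarrow> X \<subseteq> verts G"
  using cycle_verts tree_subset by (auto simp: parts_def)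

lemma finite_parts: "finite parts"
  by (rule finite_subset[of _ "Pow (verts G)"]) (use parts_subset finite_verts in auto)

lemma finite_part: "X \<in> parts \<Longrightarrow> finite X"
  by (rule finite_subset[OF parts_subset finite_verts])

lemma simple_part: "X \<in> parts \<Longrightarrow> simple_graph (induced G X)"
  by (rule simple_graph_induced[OF simple parts_subset])

lemma parts_disjoint:
  assumes "X \<in> parts" "Y \<in> parts" "X \<noteq> Y" shows "X \<inter> Y = {}"
  using assms(1)
proof (cases rule: parts_cases)
  case X: 1
  show ?thesis
    using assms(2) by (cases rule: parts_cases) (use X assms(3) tree_disjoint_cycle in blast)+
next
  case X: (2 x y)
  show ?thesis
    using assms(2)
  proof (cases rule: parts_cases)
    case 1
    then show ?thesis using X tree_disjoint_cycle by blast
  next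
    case (2 x' y')
    then show ?thesis using X assms(3) tree_eqI by blast
  qed
qed

text \<open>A tree is left only along its attaching edge, which ends on the cycle. In particular, no
  edge joins two different trees.\<close>

lemma parts_edge:
  assumes "X \<in> parts" "Y \<in> parts" "X \<noteq> Y" "u \<in> X" "v \<in> Y" "{u, v} \<in> edges G"
  shows "(u, v) \<in> links \<and> X = tree u v \<and> Y = verts C \<or>
    (v, u) \<in> links \<and> Y = tree v u \<and> X = verts C"
proof -
  have notin: "v \<notin> X" "u \<notin> Y" using parts_disjoint assms by blast+
  show ?thesis
    using assms(1)
  proof (cases rule: parts_cases)
    case X: 1
    obtain x y where xy: "(x, y) \<in> links" "Y = tree x y"
      using assms(2) by (cases rule: parts_cases) (use X assms(3) in auto)
    then have "v = x" "u = y"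
      using tree_exit[of x y v u] assms notin by (auto simp: insert_commute)
    then show ?thesis using X xy by blast
  next
    case (2 x y)
    then have "u = x" "v = y" using tree_exit[of x y u v] assms notin by auto
    moreover have "Y = verts C"
      using parts_disjoint[OF assms(2) cycle_in_parts] assms(5) linksD(3)[OF 2(1)] \<open>v = y\<close> by blast
    ultimately show ?thesis using 2 by blast
  qed
qed

text \<open>The union of the parts contains the cycle and is closed under adjacency, so
  connectedness makes it everything.\<close>

lemma Union_parts: "\<Union>parts = verts G"
proof
  show "\<Union>parts \<subseteq> verts G" using parts_subset by blast
  have step: "v \<in> \<Union>parts" if "u \<in> \<Union>parts" "{u, v} \<in> edges G" for u v
  proof -
    obtain X where X: "X \<in> parts" "u \<in> X" using \<open>u \<in> \<Union>parts\<close> by blast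
    show ?thesis using X(1)
    proof (cases rule: parts_cases)
      case 1
      show ?thesis
      proof (cases "v \<in> verts C")
        case True
        then show ?thesis using cycle_in_parts by blast
      next
        case False
        then have "(v, u) \<in> links"
          using that(2) X 1 simple_graph_edgeD[OF simple that(2)]
          by (auto simp: links_def N1_def insert_commute)
        then show ?thesis using tree_root tree_in_parts by blast
      qed
    next
      case (2 x y)
      then show ?thesis
        using X tree_exit[of x y u v] that(2) linksD(3) cycle_in_parts by blast
    qed
  qed
  obtain c where c: "c \<in> verts C" using cycle by (force simp: cycle_in_def)
  show "verts G \<subseteq> \<Union>parts"
  proof
    fix v assume "v \<in> verts G"
    then have "(c, v) \<in> (adj_rel G)\<^sup>*"
      using connected c cycle_verts by (auto simp: connected_graph_def)
    then show "v \<in> \<Union>parts"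
      by (induction rule: rtrancl_induct)
        (use c cycle_in_parts step in \<open>auto simp: adj_rel_def\<close>)
  qed
qed

section \<open>Counting and gluing along the partition\<close>

lemma card_UN_parts:
  assumes "\<And>X. X \<in> parts \<Longrightarrow> f X \<subseteq> X"
  shows "card (\<Union>X\<in>parts. f X) = (\<Sum>X\<in>parts. card (f X))"
proof (rule card_UN_disjoint)
  show "\<forall>X\<in>parts. finite (f X)" using assms finite_part finite_subset by blast
  show "\<forall>X\<in>parts. \<forall>Y\<in>parts. X \<noteq> Y \<longrightarrow> f X \<inter> f Y = {}" using assms parts_disjoint by blast
qed (rule finite_parts)

lemma card_verts: "card (verts G) = (\<Sum>X\<in>parts. card X)"
  using card_UN_parts[of "\<lambda>X. X"] Union_parts by simp

text \<open>A vertex subset without a vertex of degree at most one would contain a cycle, hence all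
  of \<open>C\<close>. This covers trees, forests and the cycle minus a vertex alike.\<close>

lemma koenig_egervary_off_cycle:
  assumes "W \<subseteq> verts G" "\<not> verts C \<subseteq> W"
  shows "koenig_egervary (induced G W)"
proof (rule koenig_egervary_if_leaves[OF simple assms(1)])
  fix U assume U: "U \<subseteq> W" "U \<noteq> {}"
  show "\<exists>u\<in>U. \<forall>a\<in>U. \<forall>b\<in>U. {u, a} \<in> edges G \<longrightarrow> {u, b} \<in> edges G \<longrightarrow> a = b"
  proof (rule ccontr)
    assume contra: "\<not> ?thesis"
    obtain D where "cycle_in G D" "verts D \<subseteq> U"
      by (rule min_degree_two_imp_cycle[OF simple _ U(2)]) (use contra U assms(1) in blast)+
    then show False using unique_cycle U(1) assms(2) by blast
  qed
qed

lemma independent_card_le_sum: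
  assumes S: "independent_set G S"
  shows "card S = (\<Sum>X\<in>parts. card (S \<inter> X))" "\<And>X. X \<in> parts \<Longrightarrow> card (S \<inter> X) \<le> alpha X"
proof -
  have "S = (\<Union>X\<in>parts. S \<inter> X)"
    using S Union_parts by (auto simp: independent_set_def)
  then show "card S = (\<Sum>X\<in>parts. card (S \<inter> X))"
    using card_UN_parts[of "\<lambda>X. S \<inter> X"] by simp
  show "card (S \<inter> X) \<le> alpha X" if "X \<in> parts" for X
    using S that parts_subset[OF that] simple_part[OF that]
    by (intro independent_set_card_le, simp_all add: independent_set_induced_iff)
      (auto simp: independent_set_def)
qed

text \<open>The only edges between parts are the attaching ones, and \<open>compat\<close> keeps
  their two ends from being chosen together.\<close>

lemma independent_UN_parts:
  assumes B: "\<And>X. X \<in> parts \<Longrightarrow> maximum_independent_set (induced G X) (B X)"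
    and compat: "\<And>x y. (x, y) \<in> links \<Longrightarrow> x \<notin> B (tree x y) \<or> y \<notin> B (verts C)"
  shows "independent_set G (\<Union>X\<in>parts. B X)" "card (\<Union>X\<in>parts. B X) = (\<Sum>X\<in>parts. alpha X)"
proof -
  have B': "B X \<subseteq> X" "independent_set G (B X)" "card (B X) = alpha X" if "X \<in> parts" for X
    using B[OF that] parts_subset[OF that]
    by (auto simp: maximum_independent_set_def independent_set_induced_iff)
  show "card (\<Union>X\<in>parts. B X) = (\<Sum>X\<in>parts. alpha X)"
    using card_UN_parts[of B] B' by simp
  have "{u, v} \<notin> edges G" if "X \<in> parts" "Y \<in> parts" "u \<in> B X" "v \<in> B Y" for X Y u v
  proof (cases "X = Y")
    case True
    then show ?thesis using B'(2) that by (auto simp: independent_set_def)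
  next
    case False
    show ?thesis
    proof
      assume "{u, v} \<in> edges G"
      then have "(u, v) \<in> links \<and> X = tree u v \<and> Y = verts C \<or>
          (v, u) \<in> links \<and> Y = tree v u \<and> X = verts C"
        using parts_edge[OF that(1,2) False] B'(1) that by blast
      then show False using compat that(3,4) by blast
    qed
  qed
  moreover have "(\<Union>X\<in>parts. B X) \<subseteq> verts G" using B'(1) parts_subset by blast
  ultimately show "independent_set G (\<Union>X\<in>parts. B X)"
    unfolding independent_set_def by blast
qed

lemma matching_UN_parts:
  assumes M: "\<And>X. X \<in> parts \<Longrightarrow> matching (induced G X) (M X)"
  shows "matching G (\<Union>X\<in>parts. M X)" "card (\<Union>X\<in>parts. M X) = (\<Sum>X\<in>parts. card (M X))"
proof -
  have M': "matching G (M X)" "\<Union>(M X) \<subseteq> X" if "X \<in> parts" for X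
    using M[OF that] by (auto simp: matching_induced_iff)
  have disj: "e \<inter> f = {}" if "X \<in> parts" "Y \<in> parts" "X \<noteq> Y" "e \<in> M X" "f \<in> M Y" for X Y e f
    using parts_disjoint[OF that(1-3)] M'(2)[OF that(1)] M'(2)[OF that(2)] that(4,5) by blast
  have nonempty: "e \<noteq> {}" if "X \<in> parts" "e \<in> M X" for X e
    using M'(1)[OF that(1)] that(2) simple by (force simp: matching_def simple_graph_def)
  show "card (\<Union>X\<in>parts. M X) = (\<Sum>X\<in>parts. card (M X))"
  proof (rule card_UN_disjoint)
    show "\<forall>X\<in>parts. finite (M X)"
      using M'(1) finite_subset[OF _ finite_edges[OF simple]] by (simp add: matching_def)
    show "\<forall>X\<in>parts. \<forall>Y\<in>parts. X \<noteq> Y \<longrightarrow> M X \<inter> M Y = {}"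
    proof (intro ballI impI equals0I)
      fix X Y e assume "X \<in> parts" "Y \<in> parts" "X \<noteq> Y" "e \<in> M X \<inter> M Y"
      then show False using disj[of X Y e e] nonempty[of X e] by simp
    qed
  qed (rule finite_parts)
  have "e \<inter> f = {}" if "X \<in> parts" "Y \<in> parts" "e \<in> M X" "f \<in> M Y" "e \<noteq> f" for X Y e f
  proof (cases "X = Y")
    case True
    then show ?thesis using that M'(1)[OF that(1)] by (simp add: matching_def)
  next
    case False
    then show ?thesis using disj that by blast
  qed
  moreover have "(\<Union>X\<in>parts. M X) \<subseteq> edges G"
    using M'(1) by (auto simp: matching_def)
  ultimately show "matching G (\<Union>X\<in>parts. M X)"
    unfolding matching_def by blast
qed

end

section \<open>Cores in the absence of the Koenig-Egervary property\<close>

locale non_ke_unicyclic_graph = unicyclic_graph +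
  assumes not_ke: "\<not> koenig_egervary G"
begin

text \<open>If \<open>x\<close> were in the core, the tree would have a matching that avoids
  \<open>x\<close> and is large enough for its own vertices; the forest \<open>F\<close> balances
  itself, and the edge \<open>{x, y}\<close> pays for \<open>y\<close>. This certifies the excluded
  property of \<open>G\<close>.\<close>

lemma root_notin_core:
  assumes xy: "(x, y) \<in> links" shows "x \<notin> core (induced G (tree x y))"
proof
  let ?T = "induced G (tree x y)"
  \<comment> \<open>Removing \<open>y\<close> as well breaks the cycle and cuts the only edge
    between the tree and the rest.\<close>
  define F where "F = verts G - tree x y - {y}"
  assume x: "x \<in> core ?T"
  have T: "simple_graph ?T" using simple_part tree_in_parts[OF xy] .
  have F: "simple_graph (induced G F)" "F \<subseteq> verts G"
    using simple by (auto simp: F_def intro!: simple_graph_induced)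
  have y: "y \<in> verts C" "y \<in> verts G" "y \<notin> tree x y"
    using linksD[OF xy] cycle_verts cycle_vertex_notin_tree[OF xy] by auto
  have "koenig_egervary (induced G (tree x y - {x}))"
    using tree_subset y by (intro koenig_egervary_off_cycle) blast+
  then have "koenig_egervary (induced ?T (verts ?T - {x}))"
    by (simp add: induced_induced)
  then obtain M1 where M1: "matching ?T M1" "x \<notin> \<Union>M1" "card (tree x y) \<le> independence_number ?T + card M1"
    using core_vertex_matching[OF T x] by auto
  obtain S1 where S1: "maximum_independent_set ?T S1" using ex_maximum_independent_set[OF T] .
  have KE: "koenig_egervary (induced G F)"
    using y by (intro koenig_egervary_off_cycle F) (auto simp: F_def)
  obtain S2 where S2: "maximum_independent_set (induced G F) S2" using ex_maximum_independent_set[OF F(1)] .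
  obtain M2 where M2: "matching (induced G F) M2" "card M2 = matching_number (induced G F)"
    using ex_maximum_matching[OF F(1)] .
  have S1': "S1 \<subseteq> tree x y" "independent_set G S1"
    using S1 tree_subset by (auto simp: maximum_independent_set_def independent_set_induced_iff)
  have S2': "S2 \<subseteq> F" "independent_set G S2"
    using S2 F by (auto simp: maximum_independent_set_def independent_set_induced_iff)
  have M1': "matching G M1" "\<Union>M1 \<subseteq> tree x y - {x}" and M2': "matching G M2" "\<Union>M2 \<subseteq> F"
    using M1 M2 by (auto simp: matching_induced_iff)
  have noedge: "{u, v} \<notin> edges G" if "u \<in> tree x y" "v \<in> F" for u v
    using tree_exit[OF xy] that by (auto simp: F_def)
  have S: "independent_set G (S1 \<union> S2)"
  proof -
    have "{u, v} \<notin> edges G" "{v, u} \<notin> edges G" if "u \<in> S1" "v \<in> S2" for u v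
      using noedge[of u v] that S1'(1) S2'(1) by (auto simp: insert_commute)
    then show ?thesis using S1' S2' unfolding independent_set_def by blast
  qed
  have fin: "finite (tree x y)" "finite F"
    using finite_subset[OF _ finite_verts] tree_subset F(2) by auto
  then have "finite S1" "finite S2"
    using S1' S2' finite_subset by blast+
  have cardS: "card (S1 \<union> S2) = independence_number ?T + independence_number (induced G F)"
  proof -
    have "S1 \<inter> S2 = {}" using S1'(1) S2'(1) by (auto simp: F_def)
    then show ?thesis
      using S1 S2 \<open>finite S1\<close> \<open>finite S2\<close>
      by (simp add: maximum_independent_set_def card_Un_disjoint)
  qed
  \<comment> \<open>The edge \<open>{x, y}\<close> can be added because \<open>M1\<close> avoids
    \<open>x\<close> and \<open>F\<close> omits \<open>y\<close>.\<close>
  have disj: "\<Union>M1 \<inter> \<Union>M2 = {}" "\<Union>{{x, y}} \<inter> \<Union>(M1 \<union> M2) = {}"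
    using M1'(2) M2'(2) y tree_root[OF xy] by (auto simp: F_def)
  have xyM: "matching G {{x, y}}" using linksD(4)[OF xy] by (simp add: matching_def)
  note M12 = matching_Un[OF simple M1'(1) M2'(1) disj(1)]
  note M = matching_Un[OF simple xyM M12(1) disj(2)]
  have "verts G = insert y (tree x y \<union> F)" using y tree_subset by (auto simp: F_def)
  moreover have "card (insert y (tree x y \<union> F)) = Suc (card (tree x y) + card F)"
  proof -
    have "y \<notin> tree x y \<union> F" "tree x y \<inter> F = {}" using y by (auto simp: F_def)
    then show ?thesis using fin by (simp add: card_Un_disjoint)
  qed
  ultimately have "card (verts G) \<le> card (S1 \<union> S2) + card ({{x, y}} \<union> (M1 \<union> M2))"
    using cardS M(2) M12(2) M1(3) M2(2) KE by (simp add: koenig_egervary_def)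
  then show False using not_ke koenig_egervaryI[OF simple S M(1)] by blast
qed

text \<open>With every root left out, the tree members are compatible with any choice on the
  cycle.\<close>

lemma ex_rootless_family:
  "\<exists>B. (\<forall>X\<in>parts. maximum_independent_set (induced G X) (B X)) \<and>
    (\<forall>x y. (x, y) \<in> links \<longrightarrow> x \<notin> B (tree x y))"
proof -
  have "\<exists>S. maximum_independent_set (induced G X) S \<and>
      (\<forall>x y. (x, y) \<in> links \<longrightarrow> X = tree x y \<longrightarrow> x \<notin> S)" if X: "X \<in> parts" for X
    using X
  proof (cases rule: parts_cases)
    case 1
    obtain S where "maximum_independent_set (induced G X) S"
      using ex_maximum_independent_set[OF simple_part[OF X]] .
    moreover have "X \<noteq> tree x y" if "(x, y) \<in> links" for x y
      using 1 tree_root[OF that] linksD(2)[OF that] by blast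
    ultimately show ?thesis by blast
  next
    case (2 x y)
    then obtain S where "maximum_independent_set (induced G X) S" "x \<notin> S"
      using root_notin_core[OF 2(1)] by (auto simp: core_def)
    \<comment> \<open>A tree determines its root, so avoiding \<open>x\<close> settles every
      representation of \<open>X\<close> as a tree.\<close>
    moreover have "x' = x" if "(x', y') \<in> links" "X = tree x' y'" for x' y'
      using tree_eqI[OF that(1) 2(1)] tree_root[OF 2(1)] that 2 by blast
    ultimately show ?thesis by blast
  qed
  then have "\<exists>B. \<forall>X\<in>parts. maximum_independent_set (induced G X) (B X) \<and>
      (\<forall>x y. (x, y) \<in> links \<longrightarrow> X = tree x y \<longrightarrow> x \<notin> B X)"
    by (rule bchoice[OF ballI])
  then show ?thesis using tree_in_parts by blast
qed

text \<open>Restriction to the parts bounds from above; gluing a rootless family attains the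
  bound.\<close>

lemma independence_number_eq: "independence_number G = (\<Sum>X\<in>parts. alpha X)"
proof (rule antisym)
  obtain S where "maximum_independent_set G S" using ex_maximum_independent_set[OF simple] .
  then have S: "independent_set G S" "card S = independence_number G"
    by (simp_all add: maximum_independent_set_def)
  have "card S \<le> (\<Sum>X\<in>parts. alpha X)"
    unfolding independent_card_le_sum(1)[OF S(1)]
    by (rule sum_mono) (rule independent_card_le_sum(2)[OF S(1)])
  then show "independence_number G \<le> (\<Sum>X\<in>parts. alpha X)" by (simp add: S(2))
next
  obtain B where B: "\<And>X. X \<in> parts \<Longrightarrow> maximum_independent_set (induced G X) (B X)"
    "\<And>x y. (x, y) \<in> links \<Longrightarrow> x \<notin> B (tree x y)"
    using ex_rootless_family by blast
  then have "independent_set G (\<Union>X\<in>parts. B X)" "card (\<Union>X\<in>parts. B X) = (\<Sum>X\<in>parts. alpha X)"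
    using independent_UN_parts[of B] by blast+
  then show "(\<Sum>X\<in>parts. alpha X) \<le> independence_number G"
    using independent_set_card_le[OF simple] by metis
qed

lemma maximum_independent_UN_parts:
  assumes "\<And>X. X \<in> parts \<Longrightarrow> maximum_independent_set (induced G X) (B X)"
    and "\<And>x y. (x, y) \<in> links \<Longrightarrow> x \<notin> B (tree x y) \<or> y \<notin> B (verts C)"
  shows "maximum_independent_set G (\<Union>X\<in>parts. B X)"
  using independent_UN_parts[of B] assms
  by (simp add: maximum_independent_set_def independence_number_eq)

text \<open>The restrictions are bounded termwise by the summands of
  \<open>independence_number_eq\<close>. As the totals agree, so does each term.\<close>

lemma maximum_independent_set_restrict:
  assumes S: "maximum_independent_set G S" and X: "X \<in> parts"
  shows "maximum_independent_set (induced G X) (S \<inter> X)"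
proof -
  have ind: "independent_set G S" using S by (simp add: maximum_independent_set_def)
  have "(\<Sum>X\<in>parts. card (S \<inter> X)) = (\<Sum>X\<in>parts. alpha X)"
    using S independent_card_le_sum(1)[OF ind] independence_number_eq
    by (simp add: maximum_independent_set_def)
  then have "card (S \<inter> X) = alpha X"
    using sum_mono_inv[of "\<lambda>X. card (S \<inter> X)" parts alpha X] independent_card_le_sum(2)[OF ind]
      X finite_parts by blast
  moreover have "independent_set (induced G X) (S \<inter> X)"
    using ind by (simp add: independent_set_induced_iff[OF parts_subset[OF X]])
      (auto simp: independent_set_def)
  ultimately show ?thesis by (simp add: maximum_independent_set_def)
qed

text \<open>Otherwise the cycle would have a matching that makes up for its missing Koenig-Egervary
  property. Together with maximum matchings of the trees it would certify that property for
  \<open>G\<close>.\<close>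

lemma cycle_vertex_notin_core:
  assumes y: "y \<in> verts C" shows "y \<notin> core (induced G (verts C))"
proof
  let ?K = "induced G (verts C)"
  assume "y \<in> core ?K"
  have "koenig_egervary (induced ?K (verts ?K - {y}))"
    using y cycle_verts by (simp add: induced_induced) (intro koenig_egervary_off_cycle; blast)
  then obtain MC where MC: "matching ?K MC" "card (verts C) \<le> alpha (verts C) + card MC"
    using core_vertex_matching[OF simple_part[OF cycle_in_parts] \<open>y \<in> core ?K\<close>] by auto
  have "\<exists>M. matching (induced G X) M \<and> card X \<le> alpha X + card M" if X: "X \<in> parts" for X
    using X
  proof (cases rule: parts_cases)
    case 1
    then show ?thesis using MC by blast
  next
    case (2 x z)
    then have "koenig_egervary (induced G X)"
      using parts_subset[OF X] linksD(3) cycle_vertex_notin_tree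
      by (intro koenig_egervary_off_cycle) blast+
    then show ?thesis
      using ex_maximum_matching[OF simple_part[OF X]]
      by (metis koenig_egervary_def order_refl verts_induced)
  qed
  then obtain M where M: "\<And>X. X \<in> parts \<Longrightarrow> matching (induced G X) (M X)"
    "\<And>X. X \<in> parts \<Longrightarrow> card X \<le> alpha X + card (M X)"
    by metis
  have "card (verts G) \<le> (\<Sum>X\<in>parts. alpha X + card (M X))"
    unfolding card_verts using M(2) by (rule sum_mono)
  also have "\<dots> = independence_number G + card (\<Union>X\<in>parts. M X)"
    using matching_UN_parts(2)[of M] M(1) by (simp add: sum.distrib independence_number_eq)
  finally have le: "card (verts G) \<le> independence_number G + card (\<Union>X\<in>parts. M X)" .
  obtain S where "maximum_independent_set G S" using ex_maximum_independent_set[OF simple] .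
  then have "koenig_egervary G"
    using le matching_UN_parts(1)[of M] M(1)
    by (intro koenig_egervaryI[OF simple, of S "\<Union>X\<in>parts. M X"]) (auto simp: maximum_independent_set_def)
  then show False using not_ke by blast
qed

text \<open>A maximum independent set of \<open>G\<close> restricts to one of each tree, which gives
  one inclusion. Conversely, a core vertex lies in every glued family, and suitable families exclude
  cycle vertices and realise any maximum independent set of a given tree.\<close>

lemma core_eq: "core G = (\<Union>(x, y)\<in>links. core (attached_tree G x y))"
proof (intro subset_antisym subsetI)
  fix v assume "v \<in> (\<Union>(x, y)\<in>links. core (attached_tree G x y))"
  then obtain x y where xy: "(x, y) \<in> links" "v \<in> core (induced G (tree x y))"
    using attached_tree_eq by auto
  show "v \<in> core G"
    unfolding core_def
  proof (intro InterI, clarify)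
    fix S assume "maximum_independent_set G S"
    then have "maximum_independent_set (induced G (tree x y)) (S \<inter> tree x y)"
      using maximum_independent_set_restrict tree_in_parts[OF xy(1)] by blast
    then show "v \<in> S" using xy(2) by (auto simp: core_def)
  qed
next
  fix v assume v: "v \<in> core G"
  obtain B where B: "\<And>X. X \<in> parts \<Longrightarrow> maximum_independent_set (induced G X) (B X)"
    "\<And>x y. (x, y) \<in> links \<Longrightarrow> x \<notin> B (tree x y)"
    using ex_rootless_family by blast
  have Bsub: "B X \<subseteq> X" if "X \<in> parts" for X
    using B(1)[OF that] parts_subset[OF that]
    by (auto simp: maximum_independent_set_def independent_set_induced_iff)
  obtain X where X: "X \<in> parts" "v \<in> X"
    using v core_subset_verts[OF simple] Union_parts by blast
  \<comment> \<open>Disjointness of the parts places \<open>v\<close> in the member for its own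
    part.\<close>
  have forced: "v \<in> B' X" if "\<And>Y. Y \<in> parts \<Longrightarrow> maximum_independent_set (induced G Y) (B' Y)"
    "\<And>x y. (x, y) \<in> links \<Longrightarrow> x \<notin> B' (tree x y) \<or> y \<notin> B' (verts C)" for B'
  proof -
    have "v \<in> (\<Union>Y\<in>parts. B' Y)"
      using v maximum_independent_UN_parts[of B', OF that] unfolding core_def by blast
    then obtain Y where Y: "Y \<in> parts" "v \<in> B' Y" by blast
    then have "v \<in> Y"
      using that(1)[OF Y(1)] parts_subset[OF Y(1)]
      by (auto simp: maximum_independent_set_def independent_set_induced_iff)
    then show ?thesis using Y X parts_disjoint by blast
  qed
  have tree_neq: "tree x y \<noteq> verts C" if "(x, y) \<in> links" for x y
    using tree_root[OF that] linksD(2)[OF that] by blast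
  show "v \<in> (\<Union>(x, y)\<in>links. core (attached_tree G x y))"
    using X(1)
  proof (cases rule: parts_cases)
    case 1
    then obtain A where A: "maximum_independent_set (induced G (verts C)) A" "v \<notin> A"
      using cycle_vertex_notin_core X(2) by (auto simp: core_def)
    \<comment> \<open>Contradiction: the roots are absent, so the cycle member can be any
      \<open>A\<close>, in particular one that avoids \<open>v\<close>.\<close>
    have "v \<in> (B(verts C := A)) X"
      by (rule forced[of "B(verts C := A)"]) (use A B tree_neq in \<open>auto\<close>)
    then show ?thesis using 1 A(2) by simp
  next
    case (2 x y)
    have "v \<in> core (induced G X)"
      unfolding core_def
    proof (intro InterI, clarify)
      fix S assume S: "maximum_independent_set (induced G X) S"
      obtain A where A: "maximum_independent_set (induced G (verts C)) A" "y \<notin> A"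
        using cycle_vertex_notin_core linksD(3)[OF 2(1)] by (auto simp: core_def)
      \<comment> \<open>\<open>S\<close> is arbitrary and may contain the root \<open>x\<close>; the
        cycle member avoids \<open>y\<close> to make room for it, and the other trees stay
        rootless.\<close>
      let ?B = "B(verts C := A, X := S)"
      have "v \<in> ?B X"
      proof (rule forced[of ?B])
        show "maximum_independent_set (induced G Y) (?B Y)" if "Y \<in> parts" for Y
          using A(1) S B(1) that by simp
        fix x' y' assume xy': "(x', y') \<in> links"
        show "x' \<notin> ?B (tree x' y') \<or> y' \<notin> ?B (verts C)"
        proof (cases "tree x' y' = X")
          case True
          then have "y' = y" using tree_eqI(2)[OF xy' 2(1)] X(2) 2(2) by blast
          then show ?thesis using A(2) 2 tree_neq by auto
        next
          case False
          then show ?thesis using B(2)[OF xy'] tree_neq[OF xy'] by simp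
        qed
      qed
      then show "v \<in> S" by simp
    qed
    then show ?thesis using 2 attached_tree_eq by force
  qed
qed

end

theorem theorem2p10:
  fixes G C :: "'a ugraph"
  assumes "simple_graph G"
    and "unicyclic G"
    and "\<not> koenig_egervary G"
    and "cycle_in G C"
  shows "core G =
    \<Union>{core (attached_tree G x y) | x y. x \<in> N1 G C \<and> y \<in> verts C \<and> {x, y} \<in> edges G}"
proof -
  interpret non_ke_unicyclic_graph G C
    by unfold_locales (use assms in \<open>auto simp: unicyclic_def\<close>)
  show ?thesis
    unfolding core_eq links_def by blast
qed

end
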